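(* Let $s\ge 2$. If a generalized quadrangle of order $(p,q)$ exists, then \[ \mathbf{RT}_s\big((pq+1)(p+1),K_{s+1},\Theta(pq)\big)=\Theta(p^3q^2), \] where the hidden constants depend only on $s$. That is, there are constants $C,c_1,c_2>0$ depending only on $s$ such that, as $p,q\to\infty$ over pairs $(p,q)$ for which a generalized quadrangle of order $(p,q)$ exists, $c_1p^3q^2\le \mathbf{RT}_s\big((pq+1)(p+1),K_{s+1},C\,pq\big)\le c_2p^3q^2$.
   Context: For a graph $G$ and integer $s\ge 2$, the $s$-independence number $\alpha_s(G)$ is the maximum number of vertices of an induced subgraph of $G$ containing no copy of $K_s$. For a graph $H$, integer $n$ and a number $f$, the Ramsey–Turán number $\mathbf{RT}_s(n,H,f)$ is the maximum number of edges of an $H$-free graph $G$ on $n$ vertices with $\alpha_s(G)<f$; if no such graph exists it is $0$. A generalized quadrangle of order $(p,q)$ is an incidence structure consisting of a set $P$ of points and a set $\mathcal L$ of lines (subsets of $P$) such that: any two points lie on at most one line; if $u$ is a point not on a line $L$, then there is a unique point $w\in L$ collinear with $u$; every line contains $p+1$ points and every point lies on $q+1$ lines. (Then $|P|=(pq+1)(p+1)$.) *)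

theory Defs
  imports Complex_Main "HOL-Library.Ramsey"
begin

text \<open>Finite simple graphs are pairs of a vertex set and a set of two-element vertex sets.\<close>

type_synonym 'a ugraph = "'a set \<times> 'a set set"

abbreviation verts :: "'a ugraph \<Rightarrow> 'a set" where "verts \<equiv> fst"

abbreviation edges :: "'a ugraph \<Rightarrow> 'a set set" where "edges \<equiv> snd"

definition simple_graph :: "'a ugraph \<Rightarrow> bool" where
  "simple_graph G \<longleftrightarrow> finite (verts G) \<and> edges G \<subseteq> nsets (verts G) 2"

definition complete_graph :: "nat \<Rightarrow> nat ugraph" where
  "complete_graph t = ({..<t}, nsets {..<t} 2)"

definition induced_subgraph :: "'a ugraph \<Rightarrow> 'a set \<Rightarrow> 'a ugraph" where
  "induced_subgraph G W = (W, {e \<in> edges G. e \<subseteq> W})"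

text \<open>Copies of \<open>H\<close> are subgraphs isomorphic to \<open>H\<close>, not necessarily induced.\<close>

definition contains_copy :: "'h ugraph \<Rightarrow> 'a ugraph \<Rightarrow> bool" where
  "contains_copy H G \<longleftrightarrow>
     (\<exists>f. inj_on f (verts H) \<and> f ` verts H \<subseteq> verts G \<and> (\<forall>e\<in>edges H. f ` e \<in> edges G))"

definition alpha :: "nat \<Rightarrow> 'a ugraph \<Rightarrow> nat" where
  "alpha s G =
     Max {card W |W. W \<subseteq> verts G \<and> \<not> contains_copy (complete_graph s) (induced_subgraph G W)}"

text \<open>
  The graphs competing in the definition of the Ramsey--Turan number. Since the conditions are
  invariant under isomorphism, the \<open>n\<close> vertices may be taken to be \<open>0, \<dots>, n - 1\<close>.
\<close>

definition RT_graphs :: "nat \<Rightarrow> nat \<Rightarrow> 'h ugraph \<Rightarrow> real \<Rightarrow> nat ugraph set" where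
  "RT_graphs s n H f =
     {G. simple_graph G \<and> verts G = {..<n} \<and> \<not> contains_copy H G \<and> real (alpha s G) < f}"

definition RT :: "nat \<Rightarrow> nat \<Rightarrow> 'h ugraph \<Rightarrow> real \<Rightarrow> nat" where
  "RT s n H f =
     (if RT_graphs s n H f = {} then 0 else Max ((\<lambda>G. card (edges G)) ` RT_graphs s n H f))"

definition collinear_in :: "'a set set \<Rightarrow> 'a \<Rightarrow> 'a \<Rightarrow> bool" where
  "collinear_in \<L> x y \<longleftrightarrow> (\<exists>L\<in>\<L>. x \<in> L \<and> y \<in> L)"

text \<open>
  Nonemptiness of the point set rules out the structure without points and lines, which
  would satisfy all other conditions vacuously for every order. Finiteness of the point set
  follows from the cardinality conditions.
\<close>

definition generalized_quadrangle :: "'a set \<Rightarrow> 'a set set \<Rightarrow> nat \<Rightarrow> nat \<Rightarrow> bool" where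
  "generalized_quadrangle P \<L> p q \<longleftrightarrow>
     P \<noteq> {} \<and> (\<forall>L\<in>\<L>. L \<subseteq> P) \<and>
     (\<forall>x\<in>P. \<forall>y\<in>P. x \<noteq> y \<longrightarrow> (\<forall>L\<in>\<L>. \<forall>M\<in>\<L>. {x, y} \<subseteq> L \<and> {x, y} \<subseteq> M \<longrightarrow> L = M)) \<and>
     (\<forall>u\<in>P. \<forall>L\<in>\<L>. u \<notin> L \<longrightarrow> (\<exists>!w. w \<in> L \<and> collinear_in \<L> u w)) \<and>
     (\<forall>L\<in>\<L>. card L = p + 1) \<and>
     (\<forall>x\<in>P. card {L \<in> \<L>. x \<in> L} = q + 1)"

text \<open>
  As a generalized quadrangle of order \<open>(p, q)\<close> is finite, it may be assumed to have natural
  numbers as points.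
\<close>

definition GQ_exists :: "nat \<Rightarrow> nat \<Rightarrow> bool" where
  "GQ_exists p q \<longleftrightarrow> (\<exists>(P :: nat set) \<L>. generalized_quadrangle P \<L> p q)"

end

theory Submission
  imports Defs "HOL-Analysis.Convex"
begin

text \<open>
  Upper bound: a neighbourhood in a \<open>K\<^bsub>s+1\<^esub>\<close>-free graph is \<open>K\<^sub>s\<close>-free, so all degrees are at
  most \<open>\<alpha>\<^sub>s\<close>.

  Lower bound: colour every incident pair (line, point) randomly with \<open>s\<close> colours and join two
  points of a line when their colours on that line differ. A generalized quadrangle has no
  triangles, so cliques of size at least 3 lie on a line and there is no \<open>K\<^bsub>s+1\<^esub>\<close>. A set of
  \<open>m = C p q\<close> points has about \<open>C p q\<^sup>2\<close> incidences, \<open>C\<close> per line on average, so it is \<open>K\<^sub>s\<close>-free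
  with probability at most \<open>exp (- \<Omega>(m q))\<close>. This beats the at most \<open>exp (m ln |P|)\<close> choices of
  the set because \<open>ln |P| = O(ln q)\<close> by Higman's inequality \<open>p \<le> q\<^sup>2\<close>. On average only a
  fraction \<open>1/s \<le> 1/2\<close> of the collinear pairs is monochromatic, so a positive fraction of them
  become edges with sufficient probability.
\<close>

subsection \<open>Counting in generalized quadrangles\<close>

locale gen_quad =
  fixes P :: "'a set" and \<L> :: "'a set set" and p q :: nat
  assumes gq: "generalized_quadrangle P \<L> p q"
begin

lemma points_nonempty: "P \<noteq> {}"
  using gq by (simp add: generalized_quadrangle_def)

lemma line_subset: "L \<in> \<L> \<Longrightarrow> L \<subseteq> P"
  using gq by (simp add: generalized_quadrangle_def)

lemma card_line: "L \<in> \<L> \<Longrightarrow> card L = p + 1"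
  using gq by (simp add: generalized_quadrangle_def)

text \<open>\<open>card\<close> of an infinite set is 0, so the positive value \<open>p + 1\<close>
  forces finiteness; \<open>finite_pencil\<close> uses the same default.\<close>

lemma finite_line: "L \<in> \<L> \<Longrightarrow> finite L"
  using card_line card.infinite by fastforce

lemma line_nonempty: "L \<in> \<L> \<Longrightarrow> L \<noteq> {}"
  using card_line by force

lemma line_unique:
  assumes "L \<in> \<L>" "M \<in> \<L>" "x \<noteq> y" "x \<in> L" "y \<in> L" "x \<in> M" "y \<in> M"
  shows "L = M"
proof -
  have "x \<in> P" "y \<in> P"
    using assms line_subset by auto
  moreover have "\<forall>x\<in>P. \<forall>y\<in>P. x \<noteq> y \<longrightarrow> (\<forall>L\<in>\<L>. \<forall>M\<in>\<L>. {x, y} \<subseteq> L \<and> {x, y} \<subseteq> M \<longrightarrow> L = M)"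
    using gq unfolding generalized_quadrangle_def by (elim conjE)
  ultimately show ?thesis
    using assms by (metis empty_subsetI insert_subset)
qed

lemma projection:
  assumes "u \<in> P" "L \<in> \<L>" "u \<notin> L"
  shows "\<exists>!w. w \<in> L \<and> collinear_in \<L> u w"
proof -
  have "\<forall>u\<in>P. \<forall>L\<in>\<L>. u \<notin> L \<longrightarrow> (\<exists>!w. w \<in> L \<and> collinear_in \<L> u w)"
    using gq unfolding generalized_quadrangle_def by (elim conjE)
  then show ?thesis
    using assms by simp
qed

definition pencil :: "'a \<Rightarrow> 'a set set" where
  "pencil x = {L \<in> \<L>. x \<in> L}"

lemma card_pencil: "x \<in> P \<Longrightarrow> card (pencil x) = q + 1"
  using gq by (simp add: generalized_quadrangle_def pencil_def)

lemma finite_pencil: "x \<in> P \<Longrightarrow> finite (pencil x)"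
  using card_pencil card.infinite by fastforce

lemma card_pencil_minus:
  assumes "L \<in> \<L>" "x \<in> L"
  shows "card (pencil x - {L}) = q"
proof -
  have "L \<in> pencil x" "x \<in> P"
    using assms line_subset by (auto simp: pencil_def)
  then show ?thesis
    using card_pencil finite_pencil by (simp add: card_Diff_singleton)
qed

lemma ex_connecting_line:
  assumes "c \<in> P" "L \<in> \<L>" "c \<notin> L"
  shows "\<exists>K\<in>\<L>. c \<in> K \<and> K \<inter> L \<noteq> {}"
  using projection[OF assms] unfolding collinear_in_def by blast

text \<open>This is the absence of triangles. The points where \<open>K\<close> and \<open>M\<close>
  meet \<open>L\<close> are both projections of \<open>c\<close> to \<open>L\<close>, hence equal,
  and then \<open>K\<close> and \<open>M\<close> share two points.\<close>

lemma connecting_line_unique: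
  assumes "L \<in> \<L>" "c \<notin> L" "K \<in> \<L>" "M \<in> \<L>" "c \<in> K" "c \<in> M" "K \<inter> L \<noteq> {}" "M \<inter> L \<noteq> {}"
  shows "K = M"
proof -
  obtain a b where ab: "a \<in> K" "a \<in> L" "b \<in> M" "b \<in> L"
    using assms by blast
  have "c \<in> P"
    using assms line_subset by blast
  then have "a = b"
    using projection[of c L] assms ab unfolding collinear_in_def by blast
  then show ?thesis
    using line_unique[of K M a c] assms ab by blast
qed

lemma card_Int_lines:
  assumes "L \<in> \<L>" "M \<in> \<L>" "L \<noteq> M" "L \<inter> M \<noteq> {}"
  shows "card (L \<inter> M) = 1"
proof -
  obtain a where a: "a \<in> L \<inter> M"
    using assms by blast
  then have "x = a" if "x \<in> L \<inter> M" for x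
    using line_unique[of L M a x] assms that by blast
  then have "L \<inter> M = {a}"
    using a by blast
  then show ?thesis by simp
qed

section \<open>Numbers of points, flags and lines\<close>

text \<open>A line other than \<open>T\<close> meets \<open>T\<close> at most once, so
  \<open>K\<close> determines \<open>w\<close>. Lines meeting \<open>T\<close> can thus be counted
  through their incidences with \<open>T\<close>.\<close>

lemma inj_on_snd_incidences:
  assumes "T \<in> \<L>" "S \<subseteq> T" and "\<And>w K. (w, K) \<in> X \<Longrightarrow> w \<in> S \<and> K \<in> \<L> \<and> w \<in> K \<and> K \<noteq> T"
  shows "inj_on snd X"
proof (rule inj_onI)
  fix a b assume "a \<in> X" "b \<in> X" "snd a = snd b"
  moreover obtain w K w' K' where "a = (w, K)" "b = (w', K')"
    by fastforce
  ultimately show "a = b"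
    using line_unique[of K T w w'] assms by (metis snd_conv subsetD)
qed

lemma card_lines_through_set:
  assumes T: "T \<in> \<L>" and S: "S \<subseteq> T"
  shows "card {K \<in> \<L>. K \<noteq> T \<and> K \<inter> S \<noteq> {}} = card S * q"
proof -
  have inj: "inj_on snd (SIGMA w:S. pencil w - {T})"
    by (rule inj_on_snd_incidences[OF T S]) (auto simp: pencil_def)
  have im: "snd ` (SIGMA w:S. pencil w - {T}) = {K \<in> \<L>. K \<noteq> T \<and> K \<inter> S \<noteq> {}}"
    by (force simp: pencil_def)
  have "finite S"
    using finite_subset[OF S finite_line[OF T]] .
  moreover have "\<forall>w\<in>S. finite (pencil w - {T})"
    using S line_subset[OF T] finite_pencil by blast
  ultimately have "card (SIGMA w:S. pencil w - {T}) = (\<Sum>w\<in>S. card (pencil w - {T}))"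
    by (rule card_SigmaI)
  also have "\<dots> = (\<Sum>w\<in>S. q)"
    using card_pencil_minus[OF T] S by (intro sum.cong refl) auto
  finally show ?thesis
    using card_image[OF inj] im by simp
qed

text \<open>A point \<open>u\<close> off a fixed line \<open>L\<close> corresponds to exactly one
  triple \<open>(w, K, u)\<close>, with \<open>w\<close> its projection to \<open>L\<close> and
  \<open>K\<close> the connecting line. There are \<open>(p + 1) * q * p\<close> triples. Finiteness
  of \<open>P\<close> comes from the same bijection, which is why both claims are proved
  together.\<close>

lemma card_points_and_finite: "card P = (p * q + 1) * (p + 1) \<and> finite P"
proof -
  obtain x where x: "x \<in> P" using points_nonempty by blast
  then have "card (pencil x) > 0"
    using card_pencil by simp
  then obtain L where L: "L \<in> \<L>"
    by (metis (no_types, lifting) card_gt_0_iff ex_in_conv mem_Collect_eq pencil_def)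
  define X where "X = (SIGMA w:L. SIGMA K:pencil w - {L}. K - {w})"
  have wP: "w \<in> P" if "w \<in> L" for w
    using L line_subset that by blast
  have offL: "u \<notin> L" if "(w, K, u) \<in> X" for w K u
  proof -
    have "w \<in> L" "w \<in> K" "u \<in> K" "K \<in> \<L>" "K \<noteq> L" "u \<noteq> w"
      using that by (simp_all add: X_def pencil_def)
    then show ?thesis using line_unique[of K L w u] L by blast
  qed
  have "inj_on (snd \<circ> snd) X"
  proof (rule inj_onI)
    fix a b assume "a \<in> X" "b \<in> X" "(snd \<circ> snd) a = (snd \<circ> snd) b"
    moreover obtain w K u w' K' u' where ab: "a = (w, K, u)" "b = (w', K', u')"
      by (metis prod.exhaust_sel)
    ultimately have u: "(w, K, u) \<in> X" "(w', K', u) \<in> X" "u' = u" by auto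
    then have K: "w \<in> L" "w \<in> K" "u \<in> K" "K \<in> \<L>" "K \<noteq> L" "w' \<in> L" "w' \<in> K'" "u \<in> K'" "K' \<in> \<L>"
      by (simp_all add: X_def pencil_def)
    then have "K = K'"
      using offL[OF u(1)] connecting_line_unique[of L u K K'] L by blast
    moreover have "w = w'"
      using line_unique[of K L w w'] L K \<open>K = K'\<close> by blast
    ultimately show "a = b" using ab u by simp
  qed
  moreover have "(snd \<circ> snd) ` X = P - L"
  proof
    show "(snd \<circ> snd) ` X \<subseteq> P - L"
      using offL line_subset by (force simp: X_def pencil_def)
    show "P - L \<subseteq> (snd \<circ> snd) ` X"
    proof
      fix u assume u: "u \<in> P - L"
      then obtain K w where "K \<in> \<L>" "u \<in> K" "w \<in> K" "w \<in> L"
        using ex_connecting_line[of u L] L by blast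
      then have "(w, K, u) \<in> X"
        using u by (auto simp: X_def pencil_def)
      then show "u \<in> (snd \<circ> snd) ` X" by force
    qed
  qed
  moreover have fin: "finite X"
    unfolding X_def using L finite_line finite_pencil wP
    by (intro finite_SigmaI) (auto simp: pencil_def)
  ultimately have 1: "card (P - L) = card X" and 2: "finite (P - L)"
    by (metis card_image, metis finite_imageI)
  have "card X = (\<Sum>w\<in>L. \<Sum>K\<in>pencil w - {L}. card (K - {w}))"
  proof -
    have "card X = (\<Sum>w\<in>L. card (SIGMA K:pencil w - {L}. K - {w}))"
      unfolding X_def using L finite_line finite_pencil wP
      by (intro card_SigmaI ballI finite_SigmaI) (auto simp: pencil_def)
    also have "\<dots> = (\<Sum>w\<in>L. \<Sum>K\<in>pencil w - {L}. card (K - {w}))"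
      using L finite_line finite_pencil wP
      by (intro sum.cong refl card_SigmaI ballI) (auto simp: pencil_def)
    finally show ?thesis .
  qed
  also have "\<dots> = (\<Sum>w\<in>L. \<Sum>K\<in>pencil w - {L}. p)"
    using finite_line card_line by (intro sum.cong refl) (auto simp: pencil_def)
  also have "\<dots> = (\<Sum>w\<in>L. q * p)"
    using card_pencil_minus[OF L] by (intro sum.cong refl) simp
  also have "\<dots> = (p + 1) * (q * p)"
    using card_line[OF L] by simp
  finally have 3: "card (P - L) = (p + 1) * (q * p)" using 1 by simp
  have fP: "finite P" using 2 finite_line[OF L] by (metis finite_Diff2)
  have "card P = card (P - L) + card L"
    using fP line_subset[OF L] by (metis card_Diff_subset card_mono finite_line[OF L] le_add_diff_inverse2)
  then show ?thesis using 3 card_line[OF L] fP by (simp add: algebra_simps)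
qed

lemmas card_points = card_points_and_finite[THEN conjunct1]
lemmas finite_points = card_points_and_finite[THEN conjunct2]

lemma finite_lines: "finite \<L>"
  using finite_points line_subset by (meson PowI finite_Pow_iff finite_subset subsetI)

text \<open>Double counting by lines and by points. The case \<open>W = P\<close> yields the number
  of lines; general \<open>W\<close> yields the exponent in the union bound.\<close>

lemma card_flags_over:
  assumes "W \<subseteq> P"
  shows "card (SIGMA L:\<L>. L \<inter> W) = card W * (q + 1)"
proof -
  have fin: "finite W" using assms finite_points finite_subset by blast
  have "card (SIGMA L:\<L>. L \<inter> W) = (\<Sum>L\<in>\<L>. card {x \<in> W. x \<in> L})"
    using finite_lines fin by (subst card_SigmaI) (auto simp: Int_def conj_commute)
  also have "\<dots> = (\<Sum>x\<in>W. card {L \<in> \<L>. x \<in> L})"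
    by (rule sum_multicount_gen[symmetric]) (use finite_lines fin in auto)
  also have "\<dots> = (\<Sum>x\<in>W. q + 1)"
    using assms card_pencil by (intro sum.cong) (auto simp: pencil_def)
  finally show ?thesis by simp
qed

lemma card_lines: "card \<L> = (p * q + 1) * (q + 1)"
proof -
  have "card (SIGMA L:\<L>. L \<inter> P) = card \<L> * (p + 1)"
  proof -
    have "(SIGMA L:\<L>. L \<inter> P) = (SIGMA L:\<L>. L)"
      using line_subset by auto
    moreover have "card (SIGMA L:\<L>. L) = (\<Sum>L\<in>\<L>. card L)"
      using finite_lines finite_line by (intro card_SigmaI) auto
    ultimately show ?thesis using card_line by simp
  qed
  then have "card \<L> * (p + 1) = (p * q + 1) * (q + 1) * (p + 1)"
    using card_flags_over[of P] card_points by (simp add: algebra_simps)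
  then show ?thesis
    by (rule mult_right_cancel[THEN iffD1, rotated]) simp
qed

section \<open>Lines meeting one or two given lines\<close>

definition meeting :: "'a set \<Rightarrow> 'a set set" where
  "meeting L = {K \<in> \<L>. K \<inter> L \<noteq> {}}"

lemma finite_meeting: "finite (meeting L)"
  using finite_lines by (simp add: meeting_def)

text \<open>Each of the \<open>p + 1\<close> points of \<open>L\<close> lies on \<open>q\<close>
  further lines, all distinct; the final \<open>+ 1\<close> is \<open>L\<close>, which meets
  itself.\<close>

lemma card_meeting:
  assumes "L \<in> \<L>"
  shows "card (meeting L) = (p + 1) * q + 1"
proof -
  have "meeting L = insert L {K \<in> \<L>. K \<noteq> L \<and> K \<inter> L \<noteq> {}}"
    unfolding meeting_def using assms line_nonempty[OF assms] by blast
  then show ?thesis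
    using card_lines_through_set[of L L] assms card_line finite_lines by simp
qed

text \<open>Every point of \<open>L\<close> lies off \<open>M\<close>, so exactly one line through
  it meets \<open>M\<close>; a transversal corresponds to its point on \<open>L\<close>.\<close>

lemma card_transversals:
  assumes L: "L \<in> \<L>" and M: "M \<in> \<L>" and disj: "L \<inter> M = {}"
  shows "card (meeting L \<inter> meeting M) = p + 1"
proof -
  define X where "X = (SIGMA w:L. {K \<in> pencil w. K \<inter> M \<noteq> {}})"
  have neq: "K \<noteq> L" if "K \<inter> M \<noteq> {}" for K
    using that disj by blast
  have "inj_on snd X"
  proof (rule inj_on_snd_incidences[OF L subset_refl])
    fix w K assume "(w, K) \<in> X"
    then have "w \<in> L" "K \<in> \<L>" "w \<in> K" "K \<inter> M \<noteq> {}"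
      by (simp_all add: X_def pencil_def)
    then show "w \<in> L \<and> K \<in> \<L> \<and> w \<in> K \<and> K \<noteq> L"
      using neq by blast
  qed
  moreover have "snd ` X = meeting L \<inter> meeting M"
  proof
    show "snd ` X \<subseteq> meeting L \<inter> meeting M"
      by (fastforce simp: X_def pencil_def meeting_def)
    show "meeting L \<inter> meeting M \<subseteq> snd ` X"
    proof
      fix K assume K: "K \<in> meeting L \<inter> meeting M"
      then obtain w where "w \<in> K" "w \<in> L"
        unfolding meeting_def by blast
      with K have "(w, K) \<in> X"
        by (simp add: X_def pencil_def meeting_def)
      then show "K \<in> snd ` X" by force
    qed
  qed
  ultimately have "card (meeting L \<inter> meeting M) = card X"
    by (metis card_image)
  also have "\<dots> = (\<Sum>w\<in>L. card {K \<in> pencil w. K \<inter> M \<noteq> {}})"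
    unfolding X_def
  proof (rule card_SigmaI[OF finite_line[OF L]])
    show "\<forall>w\<in>L. finite {K \<in> pencil w. K \<inter> M \<noteq> {}}"
      using line_subset[OF L] finite_pencil by fastforce
  qed
  also have "\<dots> = (\<Sum>w\<in>L. 1)"
  proof (intro sum.cong refl)
    fix w assume w: "w \<in> L"
    then have "w \<notin> M" "w \<in> P" using disj line_subset[OF L] by blast+
    then obtain K where K: "K \<in> \<L>" "w \<in> K" "K \<inter> M \<noteq> {}"
      using ex_connecting_line[OF _ M] by metis
    then have "{K \<in> pencil w. K \<inter> M \<noteq> {}} = {K}"
      using connecting_line_unique[OF M \<open>w \<notin> M\<close>, of _ K] unfolding pencil_def by fast
    then show "card {K \<in> pencil w. K \<inter> M \<noteq> {}} = 1" by simp
  qed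
  also have "\<dots> = p + 1" using card_line[OF L] by simp
  finally show ?thesis .
qed

lemma ex_disjoint_lines:
  assumes "p \<ge> 1" "q \<ge> 1"
  shows "\<exists>L\<in>\<L>. \<exists>M\<in>\<L>. L \<inter> M = {}"
proof -
  have "card \<L> > 0" using card_lines by simp
  then obtain L where L: "L \<in> \<L>" by fastforce
  \<comment> \<open>The two sides differ by \<open>p * q * q\<close>, so not every line meets
    \<open>L\<close>.\<close>
  have "(p + 1) * q + 1 < card \<L>"
  proof -
    have "1 * q \<le> p * q * q" using assms by (intro mult_right_mono) auto
    moreover have "p * q > 0" using assms by simp
    moreover have "p * q * q > 0" using assms by simp
    ultimately show ?thesis
      using assms unfolding card_lines by (simp add: algebra_simps)
  qed
  then have "meeting L \<noteq> \<L>" using card_meeting[OF L] by auto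
  then show ?thesis using L by (fastforce simp: meeting_def)
qed

end

text \<open>
  Higman's inequality follows Cameron's argument in its dual form. Fix disjoint lines \<open>L\<close>, \<open>M\<close>
  and let \<open>t K\<close> be the number of common transversals of \<open>L\<close> and \<open>M\<close> that meet \<open>K\<close>. For \<open>K\<close>
  ranging over the lines disjoint from both, the first two moments of \<open>t\<close> are determined, and
  their Cauchy--Schwarz inequality factors as \<open>0 \<le> (p\<^sup>2 - 1) p (q - 1) (q\<^sup>2 - p)\<close>.
\<close>

locale skew_lines = gen_quad +
  fixes L M
  assumes L: "L \<in> \<L>" and M: "M \<in> \<L>" and disj: "L \<inter> M = {}"
begin

definition trans where "trans = meeting L \<inter> meeting M"

definition rest where "rest = \<L> - (meeting L \<union> meeting M)"

lemma transD:
  assumes "T \<in> trans"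
  shows "T \<in> \<L>" "T \<inter> L \<noteq> {}" "T \<inter> M \<noteq> {}" "T \<noteq> L" "T \<noteq> M"
  using assms disj unfolding trans_def meeting_def by blast+

text \<open>Inclusion-exclusion for the two \<open>meeting\<close> sets, arranged additively to
  avoid truncated subtraction.\<close>

lemma card_rest: "card rest + 2 * (p + 1) * q + 2 = card \<L> + (p + 1)"
proof -
  have sub: "meeting L \<union> meeting M \<subseteq> \<L>" by (auto simp: meeting_def)
  then have "card \<L> = card rest + card (meeting L \<union> meeting M)"
    unfolding rest_def using finite_lines
    by (metis card_Diff_subset card_mono finite_subset le_add_diff_inverse2)
  moreover have "card (meeting L) + card (meeting M)
      = card (meeting L \<union> meeting M) + card (meeting L \<inter> meeting M)"
    by (intro card_Un_Int finite_meeting)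
  ultimately show ?thesis
    using card_meeting[OF L] card_meeting[OF M] card_transversals[OF L M disj] by simp
qed

text \<open>Exactly \<open>p - 1\<close> points of \<open>T\<close> lie off \<open>L\<close> and
  \<open>M\<close>. A further line through such a point cannot meet \<open>L\<close> or
  \<open>M\<close>, as it would form a triangle with \<open>T\<close>, so all \<open>q\<close>
  further lines belong to \<open>rest\<close>.\<close>

lemma card_rest_meeting:
  assumes "T \<in> trans"
  shows "card {K \<in> rest. K \<inter> T \<noteq> {}} = (p - 1) * q"
proof -
  note T = transD[OF assms]
  have "{K \<in> rest. K \<inter> T \<noteq> {}} = {K \<in> \<L>. K \<noteq> T \<and> K \<inter> (T - L - M) \<noteq> {}}" (is "?A = ?B")
  proof
    show "?A \<subseteq> ?B"
      using T unfolding rest_def meeting_def by blast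
    show "?B \<subseteq> ?A"
    proof
      fix K assume K: "K \<in> ?B"
      then obtain w where w: "w \<in> K" "w \<in> T" "w \<notin> L" "w \<notin> M" by blast
      have "K \<inter> L = {}"
        using connecting_line_unique[OF L \<open>w \<notin> L\<close>, of K T] K T w by blast
      moreover have "K \<inter> M = {}"
        using connecting_line_unique[OF M \<open>w \<notin> M\<close>, of K T] K T w by blast
      ultimately show "K \<in> ?A"
        using K w unfolding rest_def meeting_def by blast
    qed
  qed
  moreover have "card (T - L - M) = p - 1"
  proof -
    have "T - L - M = T - (T \<inter> L \<union> T \<inter> M)" by blast
    moreover have "card (T \<inter> L \<union> T \<inter> M) = 2"
    proof -
      have "card (T \<inter> L \<union> T \<inter> M) = card (T \<inter> L) + card (T \<inter> M)"
        using disj finite_line[OF T(1)] by (intro card_Un_disjoint) auto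
      then show ?thesis
        using card_Int_lines[OF T(1) L T(4) T(2)] card_Int_lines[OF T(1) M T(5) T(3)] by simp
    qed
    ultimately show ?thesis
      using card_Diff_subset[of "T \<inter> L \<union> T \<inter> M" T] finite_line[OF T(1)] card_line[OF T(1)]
      by (simp add: finite_subset[of _ T])
  qed
  ultimately show ?thesis
    using card_lines_through_set[of T "T - L - M"] T by auto
qed

text \<open>Distinct members of \<open>trans\<close> are disjoint, so they have \<open>p + 1\<close>
  common transversals. Two of these are \<open>L\<close> and \<open>M\<close>, and the others turn
  out to be disjoint from both.\<close>

lemma card_rest_meeting_two:
  assumes "S \<in> trans" "T \<in> trans" "S \<noteq> T"
  shows "card {K \<in> rest. K \<inter> S \<noteq> {} \<and> K \<inter> T \<noteq> {}} = p - 1"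
proof -
  note S = transD[OF assms(1)] and T = transD[OF assms(2)]
  \<comment> \<open>A common point lies off \<open>L\<close> or off \<open>M\<close>, and would have
    two connecting lines to that line.\<close>
  have dj: "S \<inter> T = {}"
  proof (rule ccontr)
    assume "S \<inter> T \<noteq> {}"
    then obtain c where "c \<in> S" "c \<in> T" by blast
    moreover have "c \<notin> L \<or> c \<notin> M" using disj by blast
    ultimately show False
      using connecting_line_unique[OF L, of c S T] connecting_line_unique[OF M, of c S T] S T assms(3)
      by blast
  qed
  \<comment> \<open>If \<open>K\<close> missed the point \<open>a\<close> of \<open>S\<close> on
    \<open>N\<close>, then \<open>S\<close> and \<open>N\<close> would both connect \<open>a\<close>
    to \<open>K\<close>. The same holds for \<open>b\<close> on \<open>T\<close>, so
    \<open>K\<close> and \<open>N\<close> share two points.\<close>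
  have aux: "K = N"
    if N: "N \<in> \<L>" "S \<inter> N \<noteq> {}" "T \<inter> N \<noteq> {}" "S \<noteq> N" "T \<noteq> N"
      and K: "K \<in> \<L>" "K \<inter> S \<noteq> {}" "K \<inter> T \<noteq> {}" "K \<inter> N \<noteq> {}" for K N
  proof -
    obtain a b where a: "a \<in> S" "a \<in> N" and b: "b \<in> T" "b \<in> N" using N by blast
    have "a \<in> K"
      using connecting_line_unique[OF K(1), of a N S] N K S a by blast
    moreover have "b \<in> K"
      using connecting_line_unique[OF K(1), of b N T] N K T b by blast
    moreover have "a \<noteq> b" using a b dj by blast
    ultimately show "K = N" using line_unique[of K N a b] a b N K by blast
  qed
  have "{K \<in> rest. K \<inter> S \<noteq> {} \<and> K \<inter> T \<noteq> {}} = meeting S \<inter> meeting T - {L, M}" (is "?A = ?B")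
  proof
    show "?A \<subseteq> ?B"
      using line_nonempty[OF L] line_nonempty[OF M] unfolding rest_def meeting_def by blast
    show "?B \<subseteq> ?A"
    proof
      fix K assume "K \<in> ?B"
      then have K: "K \<in> \<L>" "K \<inter> S \<noteq> {}" "K \<inter> T \<noteq> {}" "K \<noteq> L" "K \<noteq> M"
        unfolding meeting_def by blast+
      then have "K \<inter> L = {}" "K \<inter> M = {}"
        using aux[OF L S(2) T(2) S(4) T(4), of K] aux[OF M S(3) T(3) S(5) T(5), of K] by blast+
      with K show "K \<in> ?A"
        unfolding rest_def meeting_def by blast
    qed
  qed
  moreover have "{L, M} \<subseteq> meeting S \<inter> meeting T"
    using S T L M unfolding meeting_def by blast
  moreover have "L \<noteq> M" using disj line_nonempty[OF L] by blast
  ultimately show ?thesis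
    using card_transversals[OF S(1) T(1) dj] by (simp add: card_Diff_subset)
qed

lemma card_trans: "card trans = p + 1"
  unfolding trans_def by (rule card_transversals[OF L M disj])

lemma variance_bound:
  assumes "p \<ge> 1"
  shows "((real p + 1) * (real p - 1) * real q)\<^sup>2
    \<le> ((real p + 1) * (real p - 1) * (real p + real q)) * real (card rest)"
proof -
  define t :: "'a set \<Rightarrow> real" where "t K = (\<Sum>T\<in>trans. of_bool (K \<inter> T \<noteq> {}))" for K
  have fr: "finite rest" using finite_lines by (simp add: rest_def)
  have ft: "finite trans" using finite_meeting by (simp add: trans_def)
  have cnt: "(\<Sum>K\<in>rest. of_bool (Q K)) = real (card {K \<in> rest. Q K})" for Q
    using fr by (simp add: Int_def)
  have "(\<Sum>K\<in>rest. t K) = (\<Sum>T\<in>trans. real (card {K \<in> rest. K \<inter> T \<noteq> {}}))"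
    unfolding t_def by (subst sum.swap) (simp only: cnt)
  also have "\<dots> = (\<Sum>T\<in>trans. (real p - 1) * real q)"
    using assms card_rest_meeting by (intro sum.cong) (auto simp: of_nat_diff)
  finally have s1: "(\<Sum>K\<in>rest. t K) = (real p + 1) * (real p - 1) * real q"
    using card_trans by (simp add: algebra_simps)
  have "(\<Sum>K\<in>rest. (t K)\<^sup>2)
      = (\<Sum>K\<in>rest. \<Sum>S\<in>trans. \<Sum>T\<in>trans. of_bool (K \<inter> S \<noteq> {} \<and> K \<inter> T \<noteq> {}))"
    unfolding t_def power2_eq_square sum_product by (simp only: of_bool_conj)
  also have "\<dots> = (\<Sum>S\<in>trans. \<Sum>K\<in>rest. \<Sum>T\<in>trans. of_bool (K \<inter> S \<noteq> {} \<and> K \<inter> T \<noteq> {}))"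
    by (rule sum.swap)
  also have "\<dots> = (\<Sum>S\<in>trans. \<Sum>T\<in>trans. real (card {K \<in> rest. K \<inter> S \<noteq> {} \<and> K \<inter> T \<noteq> {}}))"
    by (rule sum.cong[OF refl], subst sum.swap) (simp only: cnt)
  also have "\<dots> = (\<Sum>S\<in>trans. (real p - 1) * (real p + real q))"
  proof (intro sum.cong refl)
    fix S assume S: "S \<in> trans"
    \<comment> \<open>The diagonal term \<open>T = S\<close> contributes \<open>(p - 1) * q\<close>,
      and each of the \<open>p\<close> other transversals contributes \<open>p - 1\<close>.\<close>
    have "(\<Sum>T\<in>trans. real (card {K \<in> rest. K \<inter> S \<noteq> {} \<and> K \<inter> T \<noteq> {}}))
      = real (card {K \<in> rest. K \<inter> S \<noteq> {}})
        + (\<Sum>T\<in>trans - {S}. real (card {K \<in> rest. K \<inter> S \<noteq> {} \<and> K \<inter> T \<noteq> {}}))"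
      using ft S by (subst sum.remove[of _ S]) auto
    also have "\<dots> = real ((p - 1) * q) + (\<Sum>T\<in>trans - {S}. real (p - 1))"
      using S card_rest_meeting card_rest_meeting_two by (intro arg_cong2[where f = "(+)"] sum.cong) auto
    also have "\<dots> = (real p - 1) * (real p + real q)"
      using assms card_trans ft S by (simp add: card_Diff_singleton of_nat_diff algebra_simps)
    finally show "(\<Sum>T\<in>trans. real (card {K \<in> rest. K \<inter> S \<noteq> {} \<and> K \<inter> T \<noteq> {}}))
      = (real p - 1) * (real p + real q)" .
  qed
  finally have s2: "(\<Sum>K\<in>rest. (t K)\<^sup>2) = (real p + 1) * (real p - 1) * (real p + real q)"
    using card_trans by (simp add: algebra_simps)
  have "(\<Sum>K\<in>rest. t K)\<^sup>2 \<le> (\<Sum>K\<in>rest. (t K)\<^sup>2) * real (card rest)"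
    by (rule sum_squared_le_sum_of_squares[of t rest])
  then show ?thesis unfolding s1 s2 .
qed

end

lemma (in gen_quad) higman:
  assumes "p \<ge> 2" "q \<ge> 2"
  shows "p \<le> q\<^sup>2"
proof -
  obtain L M where "L \<in> \<L>" "M \<in> \<L>" "L \<inter> M = {}"
    using ex_disjoint_lines assms by auto
  then interpret skew_lines P \<L> p q L M
    by unfold_locales
  define a b where "a = real p" and "b = real q"
  have ab: "a \<ge> 2" "b \<ge> 2" using assms by (auto simp: a_def b_def)
  have "real (card rest) = (a * b + 1) * (b + 1) + (a + 1) - 2 * (a + 1) * b - 2"
    using card_rest[unfolded card_lines, THEN arg_cong[where f = real]]
    by (simp add: a_def b_def algebra_simps)
  then have "((a + 1) * (a - 1) * b)\<^sup>2
    \<le> ((a + 1) * (a - 1) * (a + b)) * ((a * b + 1) * (b + 1) + (a + 1) - 2 * (a + 1) * b - 2)"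
    using variance_bound assms by (simp add: a_def b_def)
  then have "0 \<le> ((a + 1) * (a - 1)) * (a * (b - 1) * (b\<^sup>2 - a))"
    by (simp add: algebra_simps power2_eq_square)
  \<comment> \<open>Here \<open>p \<ge> 2\<close> and \<open>q \<ge> 2\<close> enter: they make the
    factors to be cancelled strictly positive.\<close>
  moreover have "(a + 1) * (a - 1) > 0" "a * (b - 1) > 0" using ab by simp_all
  ultimately have "b\<^sup>2 - a \<ge> 0"
    by (simp add: zero_le_mult_iff mult_less_0_iff)
  then have "real p \<le> real (q\<^sup>2)" by (simp add: a_def b_def)
  then show ?thesis by simp
qed

section \<open>Relabelling the points of a quadrangle\<close>

text \<open>\<open>GQ_exists\<close> allows any set of naturals as points, whereas
  \<open>RT_graphs\<close> fixes the vertex set \<open>{..<n}\<close>; this lemma bridges the two.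
  As all lines lie in \<open>P\<close>, where \<open>h\<close> is injective, incidence transfers in
  both directions.\<close>

lemma generalized_quadrangle_image:
  assumes gq: "generalized_quadrangle P \<L> p q" and inj: "inj_on h P"
  shows "generalized_quadrangle (h ` P) ((`) h ` \<L>) p q"
  unfolding generalized_quadrangle_def
proof (intro conjI ballI impI)
  have sub: "\<forall>L\<in>\<L>. L \<subseteq> P"
    using gq unfolding generalized_quadrangle_def by (elim conjE)
  have uniq: "\<forall>x\<in>P. \<forall>y\<in>P. x \<noteq> y \<longrightarrow> (\<forall>L\<in>\<L>. \<forall>M\<in>\<L>. {x, y} \<subseteq> L \<and> {x, y} \<subseteq> M \<longrightarrow> L = M)"
    using gq unfolding generalized_quadrangle_def by (elim conjE)
  have proj: "\<forall>u\<in>P. \<forall>L\<in>\<L>. u \<notin> L \<longrightarrow> (\<exists>!w. w \<in> L \<and> collinear_in \<L> u w)"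
    using gq unfolding generalized_quadrangle_def by (elim conjE)
  have cl: "\<forall>L\<in>\<L>. card L = p + 1"
    using gq unfolding generalized_quadrangle_def by (elim conjE)
  have cp: "\<forall>x\<in>P. card {L \<in> \<L>. x \<in> L} = q + 1"
    using gq unfolding generalized_quadrangle_def by (elim conjE)
  have ne: "P \<noteq> {}"
    using gq unfolding generalized_quadrangle_def by (elim conjE)
  have mem: "h x \<in> h ` L \<longleftrightarrow> x \<in> L" if "x \<in> P" "L \<in> \<L>" for x L
    using inj_on_image_mem_iff[OF inj] that sub by blast
  have col: "collinear_in ((`) h ` \<L>) (h x) (h y) \<longleftrightarrow> collinear_in \<L> x y" if "x \<in> P" "y \<in> P" for x y
    using that mem by (simp add: collinear_in_def)
  show "h ` P \<noteq> {}" using ne by simp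
  show "L \<subseteq> h ` P" if "L \<in> (`) h ` \<L>" for L
    using that sub by blast
  show "card L = p + 1" if L: "L \<in> (`) h ` \<L>" for L
  proof -
    obtain K where "K \<in> \<L>" "L = h ` K" using L by blast
    then show ?thesis
      using cl sub card_image[OF inj_on_subset[OF inj]] by metis
  qed
  show "L = M"
    if *: "x \<in> h ` P" "y \<in> h ` P" "x \<noteq> y" "L \<in> (`) h ` \<L>" "M \<in> (`) h ` \<L>" "{x, y} \<subseteq> L \<and> {x, y} \<subseteq> M"
    for x y L M
  proof -
    obtain a b K N where ab: "a \<in> P" "b \<in> P" "x = h a" "y = h b" and
      KN: "K \<in> \<L>" "N \<in> \<L>" "L = h ` K" "M = h ` N"
      using * by (elim imageE)
    have "h a \<in> h ` K" "h b \<in> h ` K" "h a \<in> h ` N" "h b \<in> h ` N"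
      using * ab KN by simp_all
    then have "{a, b} \<subseteq> K \<and> {a, b} \<subseteq> N"
      using mem ab KN by simp
    moreover have "a \<noteq> b"
      using *(3) ab by blast
    ultimately have "K = N"
      using uniq[rule_format, OF ab(1,2) _ KN(1,2)] by simp
    then show ?thesis using KN by simp
  qed
  show "\<exists>!w. w \<in> L \<and> collinear_in ((`) h ` \<L>) u w"
    if *: "u \<in> h ` P" "L \<in> (`) h ` \<L>" "u \<notin> L" for u L
  proof -
    obtain a K where a: "a \<in> P" "u = h a" "K \<in> \<L>" "L = h ` K"
      using * by (elim imageE)
    then have "a \<notin> K" using * by blast
    then have "\<exists>!w. w \<in> K \<and> collinear_in \<L> a w"
      using proj[rule_format, OF a(1,3)] by simp
    then obtain w where w: "w \<in> K" "collinear_in \<L> a w"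
      and un: "\<And>v. v \<in> K \<Longrightarrow> collinear_in \<L> a v \<Longrightarrow> v = w"
      by metis
    have KP: "K \<subseteq> P" using a sub by blast
    show ?thesis
    proof (rule ex1I[of _ "h w"])
      show "h w \<in> L \<and> collinear_in ((`) h ` \<L>) u (h w)"
        using w a(2,4) col[OF a(1), of w] KP by blast
      fix v assume v: "v \<in> L \<and> collinear_in ((`) h ` \<L>) u v"
      then obtain b where b: "b \<in> K" "v = h b" using a(4) by blast
      then have "collinear_in \<L> a b" using v a(2) col[OF a(1), of b] KP by blast
      then show "v = h w" using un[OF b(1)] b(2) by simp
    qed
  qed
  show "card {L \<in> (`) h ` \<L>. x \<in> L} = q + 1" if x: "x \<in> h ` P" for x
  proof -
    obtain a where a: "a \<in> P" "x = h a" using x by blast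
    have "{L \<in> (`) h ` \<L>. x \<in> L} = (`) h ` {L \<in> \<L>. a \<in> L}"
      unfolding a(2) using mem[OF a(1)] by auto
    moreover have "inj_on ((`) h) {L \<in> \<L>. a \<in> L}"
    proof (rule inj_onI)
      fix K N assume "K \<in> {L \<in> \<L>. a \<in> L}" "N \<in> {L \<in> \<L>. a \<in> L}" "h ` K = h ` N"
      then show "K = N" using inj_on_image_eq_iff[OF inj, of K N] sub by simp
    qed
    ultimately show ?thesis
      using cp a by (simp add: card_image)
  qed
qed

subsection \<open>Cliques and Ramsey--Turan numbers\<close>

lemma contains_complete_graph_iff:
  "contains_copy (complete_graph t) G \<longleftrightarrow>
    (\<exists>f. inj_on f {..<t} \<and> f ` {..<t} \<subseteq> verts G \<and>
      (\<forall>i<t. \<forall>j<t. i \<noteq> j \<longrightarrow> {f i, f j} \<in> edges G))"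
proof -
  have "(\<forall>e\<in>nsets {..<t} 2. f ` e \<in> edges G) \<longleftrightarrow>
      (\<forall>i<t. \<forall>j<t. i \<noteq> j \<longrightarrow> {f i, f j} \<in> edges G)" for f :: "nat \<Rightarrow> 'a"
    by (auto simp: nsets_2_eq)
  then show ?thesis
    by (simp add: contains_copy_def complete_graph_def)
qed

lemma finite_clique_free_sets:
  "finite (verts G) \<Longrightarrow>
    finite {card W |W. W \<subseteq> verts G \<and> \<not> contains_copy H (induced_subgraph G W)}"
  by (rule finite_subset[of _ "card ` Pow (verts G)"]) auto

lemma card_le_alpha:
  assumes "finite (verts G)" "W \<subseteq> verts G"
    and "\<not> contains_copy (complete_graph s) (induced_subgraph G W)"
  shows "card W \<le> alpha s G"
  unfolding alpha_def using assms finite_clique_free_sets by (intro Max_ge) blast+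

text \<open>It suffices to test sets of exactly \<open>m\<close> vertices, because a larger
  \<open>K_s\<close>-free set has an \<open>m\<close>-subset, which is again
  \<open>K_s\<close>-free.\<close>

lemma alpha_lessI:
  fixes G :: "'a ugraph"
  assumes fin: "finite (verts G)" and "s \<ge> 1"
    and *: "\<And>W. W \<subseteq> verts G \<Longrightarrow> card W = m \<Longrightarrow>
      contains_copy (complete_graph s) (induced_subgraph G W)"
  shows "alpha s G < m"
proof -
  let ?A = "{card W |W. W \<subseteq> verts G \<and> \<not> contains_copy (complete_graph s) (induced_subgraph G W)}"
  \<comment> \<open>The empty set is a competitor because \<open>s \<ge> 1\<close>, so the
    \<open>Max\<close> in \<open>alpha\<close> is attained.\<close>
  have "\<not> contains_copy (complete_graph s) (induced_subgraph G {})"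
    using \<open>s \<ge> 1\<close> by (auto simp: contains_complete_graph_iff induced_subgraph_def lessThan_empty_iff)
  then have "card ({} :: 'a set) \<in> ?A" by (intro CollectI exI[of _ "{}"]) simp
  then have "?A \<noteq> {}" by (metis empty_iff)
  then have "alpha s G \<in> ?A"
    unfolding alpha_def by (rule Max_in[OF finite_clique_free_sets[OF fin]])
  then have "\<exists>W. alpha s G = card W \<and> W \<subseteq> verts G \<and>
      \<not> contains_copy (complete_graph s) (induced_subgraph G W)"
    by (rule CollectD)
  then obtain W where W: "alpha s G = card W" "W \<subseteq> verts G"
    "\<not> contains_copy (complete_graph s) (induced_subgraph G W)"
    by metis
  show ?thesis
  proof (rule ccontr)
    assume "\<not> alpha s G < m"
    then have "m \<le> card W" using W(1) by simp
    then obtain U where U: "U \<subseteq> W" "card U = m"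
      using obtain_subset_with_card_n by metis
    have "contains_copy (complete_graph s) (induced_subgraph G U)"
      using *[of U] U W(2) by simp
    then obtain f where "inj_on f {..<s}" "f ` {..<s} \<subseteq> U"
      "\<forall>i<s. \<forall>j<s. i \<noteq> j \<longrightarrow> {f i, f j} \<in> edges G \<and> {f i, f j} \<subseteq> U"
      unfolding contains_complete_graph_iff induced_subgraph_def by auto
    moreover have "{f i, f j} \<subseteq> W" if "{f i, f j} \<subseteq> U" for i j
      using that U by blast
    ultimately have "contains_copy (complete_graph s) (induced_subgraph G W)"
      using U(1) unfolding contains_complete_graph_iff induced_subgraph_def fst_conv snd_conv mem_Collect_eq
      by (metis subset_trans)
    then show False using W(3) by simp
  qed
qed

section \<open>The upper bound for Ramsey--Turan numbers\<close>

lemma card_edges_le_alpha: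
  assumes G: "simple_graph G" and free: "\<not> contains_copy (complete_graph (s + 1)) G"
  shows "card (edges G) \<le> card (verts G) * alpha s G"
proof -
  define nb where "nb v = {u \<in> verts G. {v, u} \<in> edges G}" for v
  have fin: "finite (verts G)" and sub: "edges G \<subseteq> nsets (verts G) 2"
    using G by (auto simp: simple_graph_def)
  have no_loop: "{v, v} \<notin> edges G" for v
    using sub by (auto simp: nsets_def)
  have deg: "card (nb v) \<le> alpha s G" if v: "v \<in> verts G" for v
  proof (rule card_le_alpha[OF fin])
    show "nb v \<subseteq> verts G" by (auto simp: nb_def)
    show "\<not> contains_copy (complete_graph s) (induced_subgraph G (nb v))"
    proof
      assume "contains_copy (complete_graph s) (induced_subgraph G (nb v))"
      then obtain f where f: "inj_on f {..<s}" "f ` {..<s} \<subseteq> nb v"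
        "\<forall>i<s. \<forall>j<s. i \<noteq> j \<longrightarrow> {f i, f j} \<in> edges G"
        by (auto simp: contains_complete_graph_iff induced_subgraph_def)
      have nbf: "{v, f i} \<in> edges G" "f i \<in> verts G" "f i \<noteq> v" if "i < s" for i
        using f(2) that no_loop[of v] by (auto simp: nb_def)
      \<comment> \<open>Adding \<open>v\<close> as vertex number \<open>s\<close> turns a
        \<open>K_s\<close> in its neighbourhood into a forbidden \<open>K_{s+1}\<close>.\<close>
      have "inj_on (f(s := v)) {..<s + 1}"
      proof -
        have "v \<notin> f ` {..<s}" using nbf(3) by blast
        then show ?thesis
          using inj_on_fun_updI[OF f(1)] by (simp add: lessThan_Suc)
      qed
      moreover have "(f(s := v)) ` {..<s + 1} \<subseteq> verts G"
        using nbf(2) v by (auto simp: less_Suc_eq)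
      moreover have "{(f(s := v)) i, (f(s := v)) j} \<in> edges G" if "i < s + 1" "j < s + 1" "i \<noteq> j" for i j
        using that f(3) nbf(1)[of i] nbf(1)[of j] by (auto simp: less_Suc_eq insert_commute)
      ultimately show False
        using free unfolding contains_complete_graph_iff by blast
    qed
  qed
  \<comment> \<open>Edges are covered by ordered adjacent pairs; the factor 2 of the degree sum is
    given away.\<close>
  have "edges G \<subseteq> (\<lambda>(v, u). {v, u}) ` (SIGMA v:verts G. nb v)"
  proof
    fix e assume e: "e \<in> edges G"
    then obtain v u where "e = {v, u}" "v \<in> verts G" "u \<in> verts G"
      using sub nsets2_E by (metis subsetD)
    then show "e \<in> (\<lambda>(v, u). {v, u}) ` (SIGMA v:verts G. nb v)"
      using e by (auto simp: nb_def)
  qed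
  moreover have finS: "finite (SIGMA v:verts G. nb v)"
    using fin by (auto simp: nb_def)
  ultimately have "card (edges G) \<le> card (SIGMA v:verts G. nb v)"
    by (rule surj_card_le[rotated])
  also have "\<dots> = (\<Sum>v\<in>verts G. card (nb v))"
    using fin by (intro card_SigmaI) (auto simp: nb_def)
  also have "\<dots> \<le> card (verts G) * alpha s G"
    using sum_bounded_above[of "verts G" "\<lambda>v. card (nb v)" "alpha s G"] deg by simp
  finally show ?thesis .
qed

lemma finite_RT_graphs: "finite (RT_graphs s n H f)"
proof (rule finite_subset)
  show "RT_graphs s n H f \<subseteq> {{..<n}} \<times> Pow (Pow {..<n})"
  proof
    fix G assume "G \<in> RT_graphs s n H f"
    then have "fst G = {..<n}" "snd G \<subseteq> nsets {..<n} 2"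
      unfolding RT_graphs_def simple_graph_def by auto
    moreover have "nsets {..<n} 2 \<subseteq> Pow {..<n}" by (auto simp: nsets_def)
    ultimately show "G \<in> {{..<n}} \<times> Pow (Pow {..<n})"
      by (simp add: mem_Times_iff)
  qed
qed simp

lemma card_edges_le_RT:
  assumes "G \<in> RT_graphs s n H f"
  shows "card (edges G) \<le> RT s n H f"
  using assms finite_RT_graphs[of s n H f] by (auto simp: RT_def intro!: Max_ge)

text \<open>The assumption \<open>f \<ge> 0\<close> covers the case without competing graphs, where
  \<open>RT\<close> is 0 by convention.\<close>

lemma RT_le:
  assumes "f \<ge> 0"
  shows "real (RT s n (complete_graph (s + 1)) f) \<le> real n * f"
proof (cases "RT_graphs s n (complete_graph (s + 1)) f = {}")
  case False
  let ?R = "RT_graphs s n (complete_graph (s + 1)) f"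
  have "RT s n (complete_graph (s + 1)) f \<in> (\<lambda>G. card (edges G)) ` ?R"
    unfolding RT_def if_not_P[OF False] using False by (intro Max_in finite_imageI finite_RT_graphs) auto
  then obtain G where G: "G \<in> ?R" "RT s n (complete_graph (s + 1)) f = card (edges G)"
    by blast
  then have "card (edges G) \<le> n * alpha s G" and a: "real (alpha s G) < f"
    using card_edges_le_alpha[of G s] by (simp_all add: RT_graphs_def)
  then have "real (card (edges G)) \<le> real n * real (alpha s G)"
    by (metis of_nat_le_iff of_nat_mult)
  also have "\<dots> \<le> real n * f"
    using a by (intro mult_left_mono) auto
  finally show ?thesis using G by simp
qed (use assms in \<open>simp add: RT_def\<close>)


subsection \<open>Random colourings of the flags\<close>

text \<open>Probabilities are expressed as quotients of cardinalities. This is independence: a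
  random function avoids the prescribed values on \<open>D\<close> with probability
  \<open>(1 - 1/s) ^ card D\<close>.\<close>

lemma card_functions_avoiding:
  assumes "finite F" "D \<subseteq> F" "\<And>x. x \<in> D \<Longrightarrow> c x < s"
  shows "card {f \<in> F \<rightarrow>\<^sub>E {..<s}. \<forall>x\<in>D. f x \<noteq> c x} = (s - 1) ^ card D * s ^ (card F - card D)"
proof -
  have fin: "finite D" using assms finite_subset by blast
  have "{f \<in> F \<rightarrow>\<^sub>E {..<s}. \<forall>x\<in>D. f x \<noteq> c x}
      = (\<Pi>\<^sub>E x\<in>F. if x \<in> D then {..<s} - {c x} else {..<s})"
    using assms(2) by (auto simp: PiE_def Pi_def split: if_splits)
  also have "card \<dots> = (\<Prod>x\<in>F. if x \<in> D then s - 1 else s)"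
    using assms by (subst card_PiE) (auto intro!: prod.cong)
  also have "\<dots> = (s - 1) ^ card D * s ^ card (F - D)"
    using assms by (simp add: prod.If_cases Int_absorb1 Diff_eq)
  finally show ?thesis
    using assms fin by (simp add: card_Diff_subset)
qed

text \<open>Two given points receive equal values with probability at most \<open>1 / card S\<close>
  for nonempty \<open>S\<close>: the value at \<open>b\<close> is copied from \<open>a\<close>, so
  deleting it loses no information.\<close>

lemma card_functions_agreeing_le:
  assumes "finite F" "finite S" "a \<in> F" "b \<in> F" "a \<noteq> b"
  shows "card {f \<in> F \<rightarrow>\<^sub>E S. f a = f b} \<le> card S ^ (card F - 1)"
proof -
  have inj: "inj_on (\<lambda>f. restrict f (F - {b})) {f \<in> F \<rightarrow>\<^sub>E S. f a = f b}"
  proof (rule inj_onI)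
    fix f g assume f: "f \<in> {f \<in> F \<rightarrow>\<^sub>E S. f a = f b}" and g: "g \<in> {f \<in> F \<rightarrow>\<^sub>E S. f a = f b}"
      and eq: "restrict f (F - {b}) = restrict g (F - {b})"
    have *: "f x = g x" if "x \<in> F - {b}" for x
      using fun_cong[OF eq, of x] that by simp
    moreover have "f b = g b"
      using *[of a] f g assms by simp
    ultimately have "f x = g x" if "x \<in> F" for x
      using that by blast
    with f g show "f = g"
      by (intro PiE_ext[of f F "\<lambda>_. S" g]) auto
  qed
  have "card {f \<in> F \<rightarrow>\<^sub>E S. f a = f b} \<le> card (F - {b} \<rightarrow>\<^sub>E S)"
  proof (rule card_inj_on_le[OF inj])
    show "(\<lambda>f. restrict f (F - {b})) ` {f \<in> F \<rightarrow>\<^sub>E S. f a = f b} \<subseteq> F - {b} \<rightarrow>\<^sub>E S"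
    proof (rule image_subsetI)
      fix f assume "f \<in> {f \<in> F \<rightarrow>\<^sub>E S. f a = f b}"
      then have "\<forall>x\<in>F - {b}. f x \<in> S" by auto
      then show "restrict f (F - {b}) \<in> F - {b} \<rightarrow>\<^sub>E S" by (simp add: restrict_PiE_iff)
    qed
    show "finite (F - {b} \<rightarrow>\<^sub>E S)"
      using assms by (simp add: finite_PiE)
  qed
  then show ?thesis
    using assms by (simp add: card_funcsetE)
qed


section \<open>The graph of a colouring of the flags\<close>

context gen_quad
begin

definition flags :: "('a set \<times> 'a) set" where
  "flags = (SIGMA L:\<L>. L)"

text \<open>The line is kept because the colour of a point depends on it. Two points determine their
  line, so no pair of points occurs twice.\<close>

definition collinear_pairs :: "('a set \<times> 'a set) set" where
  "collinear_pairs = (SIGMA L:\<L>. nsets L 2)"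

definition mono_pairs :: "('a set \<times> 'a \<Rightarrow> nat) \<Rightarrow> ('a set \<times> 'a set) set" where
  "mono_pairs f = {(L, e) \<in> collinear_pairs. \<forall>x\<in>e. \<forall>y\<in>e. f (L, x) = f (L, y)}"

definition rainbow_on :: "nat \<Rightarrow> ('a set \<times> 'a \<Rightarrow> nat) \<Rightarrow> 'a set \<Rightarrow> bool" where
  "rainbow_on s f W \<longleftrightarrow> (\<exists>L\<in>\<L>. {..<s} \<subseteq> (\<lambda>x. f (L, x)) ` (L \<inter> W))"

definition colour_graph :: "('a set \<times> 'a \<Rightarrow> nat) \<Rightarrow> 'a ugraph" where
  "colour_graph f = (P, snd ` (collinear_pairs - mono_pairs f))"

lemma finite_flags: "finite flags"
  unfolding flags_def using finite_lines finite_line by (intro finite_SigmaI) auto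

lemma finite_collinear_pairs: "finite collinear_pairs"
  unfolding collinear_pairs_def using finite_lines finite_line
  by (intro finite_SigmaI finite_imp_finite_nsets) auto

lemma card_collinear_pairs: "card collinear_pairs = card \<L> * ((p + 1) choose 2)"
proof -
  have "card collinear_pairs = (\<Sum>L\<in>\<L>. card (nsets L 2))"
    unfolding collinear_pairs_def
    by (rule card_SigmaI) (use finite_lines finite_line finite_imp_finite_nsets in auto)
  also have "\<dots> = (\<Sum>L\<in>\<L>. (p + 1) choose 2)"
    using finite_line card_line by (intro sum.cong refl) (simp add: card_nsets)
  finally show ?thesis by simp
qed

lemma card_edges_colour_graph:
  "card (edges (colour_graph f)) = card collinear_pairs - card (mono_pairs f)"
proof -
  have "inj_on snd collinear_pairs"
  proof (rule inj_onI)
    fix a b assume "a \<in> collinear_pairs" "b \<in> collinear_pairs" "snd a = snd b"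
    then obtain L M e where ab: "a = (L, e)" "b = (M, e)" "L \<in> \<L>" "M \<in> \<L>" "e \<in> nsets L 2" "e \<in> nsets M 2"
      unfolding collinear_pairs_def by force
    obtain x y where "e = {x, y}" "x \<in> L" "y \<in> L" "x \<noteq> y"
      using ab(5) nsets2_E by metis
    moreover have "e \<subseteq> M" using ab(6) by (simp add: nsets_def)
    ultimately show "a = b" using ab line_unique[of L M x y] by simp
  qed
  then have "card (edges (colour_graph f)) = card (collinear_pairs - mono_pairs f)"
    unfolding colour_graph_def snd_conv by (intro card_image inj_on_diff)
  also have "\<dots> = card collinear_pairs - card (mono_pairs f)"
    using finite_collinear_pairs by (intro card_Diff_subset) (auto simp: mono_pairs_def intro: finite_subset)
  finally show ?thesis .
qed

lemma edge_colour_graph_iff: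
  "{x, y} \<in> edges (colour_graph f) \<longleftrightarrow>
    x \<noteq> y \<and> (\<exists>L\<in>\<L>. x \<in> L \<and> y \<in> L \<and> f (L, x) \<noteq> f (L, y))"
proof -
  have "{x, y} \<in> edges (colour_graph f) \<longleftrightarrow>
      (\<exists>L. (L, {x, y}) \<in> collinear_pairs \<and> (L, {x, y}) \<notin> mono_pairs f)"
    by (force simp: colour_graph_def)
  also have "\<dots> \<longleftrightarrow> (\<exists>L\<in>\<L>. x \<noteq> y \<and> x \<in> L \<and> y \<in> L \<and> f (L, x) \<noteq> f (L, y))"
    by (auto simp: collinear_pairs_def mono_pairs_def)
  finally show ?thesis by blast
qed

lemma simple_colour_graph: "simple_graph (colour_graph f)"
proof -
  have "snd ` (collinear_pairs - mono_pairs f) \<subseteq> nsets P 2"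
    using line_subset by (force simp: collinear_pairs_def nsets_def)
  then show ?thesis
    using finite_points by (simp add: simple_graph_def colour_graph_def)
qed

text \<open>The line through two clique vertices contains all the others, since otherwise a triangle
  arises. On that line the \<open>s + 1\<close> vertices would need distinct colours out of
  \<open>s\<close>.\<close>

lemma colour_graph_clique_free:
  assumes s: "s \<ge> 2" and f: "\<And>L x. L \<in> \<L> \<Longrightarrow> x \<in> L \<Longrightarrow> f (L, x) < s"
  shows "\<not> contains_copy (complete_graph (s + 1)) (colour_graph f)"
proof
  assume "contains_copy (complete_graph (s + 1)) (colour_graph f)"
  then obtain g where adj: "\<forall>i<s+1. \<forall>j<s+1. i \<noteq> j \<longrightarrow> {g i, g j} \<in> edges (colour_graph f)"
    unfolding contains_complete_graph_iff by blast
  have E: "g i \<noteq> g j \<and> (\<exists>L\<in>\<L>. g i \<in> L \<and> g j \<in> L \<and> f (L, g i) \<noteq> f (L, g j))"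
    if "i < s + 1" "j < s + 1" "i \<noteq> j" for i j
    using adj[rule_format, OF that] unfolding edge_colour_graph_iff .
  have "g 0 \<noteq> g 1" and "\<exists>L\<in>\<L>. g 0 \<in> L \<and> g 1 \<in> L"
    using E[of 0 1] s by auto
  then obtain L where L: "L \<in> \<L>" "g 0 \<in> L" "g 1 \<in> L" by blast
  have on_L: "g i \<in> L" if i: "i < s + 1" for i
  proof (cases "i = 0 \<or> i = 1")
    case False
    then obtain K M where K: "K \<in> \<L>" "g i \<in> K" "g 0 \<in> K" and M: "M \<in> \<L>" "g i \<in> M" "g 1 \<in> M"
      using E[of i 0] E[of i 1] i s by auto
    show ?thesis
    proof (rule ccontr)
      assume "g i \<notin> L"
      then have "K = M"
        using connecting_line_unique[OF L(1), of "g i" K M] K M L by blast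
      then have "K = L"
        using line_unique[of K L "g 0" "g 1"] K M L \<open>g 0 \<noteq> g 1\<close> by blast
      then show False using \<open>g i \<notin> L\<close> K by simp
    qed
  qed (use L in auto)
  have "inj_on (\<lambda>i. f (L, g i)) {..<s + 1}"
  proof (rule inj_onI)
    fix i j assume ij: "i \<in> {..<s + 1}" "j \<in> {..<s + 1}" "f (L, g i) = f (L, g j)"
    show "i = j"
    proof (rule ccontr)
      assume "i \<noteq> j"
      then obtain K where K: "K \<in> \<L>" "g i \<in> K" "g j \<in> K" "f (K, g i) \<noteq> f (K, g j)" "g i \<noteq> g j"
        using E[of i j] ij by auto
      \<comment> \<open>The line witnessing the edge must be \<open>L\<close>, as both points lie on
        \<open>L\<close>; hence the colours differ on \<open>L\<close> itself.\<close>
      then have "K = L"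
        using line_unique[of K L "g i" "g j"] L(1) on_L[of i] on_L[of j] ij by simp
      then show False using K ij by simp
    qed
  qed
  moreover have "(\<lambda>i. f (L, g i)) ` {..<s + 1} \<subseteq> {..<s}"
    using f L on_L by auto
  ultimately have "card {..<s + 1} \<le> card {..<s}"
    by (rule card_inj_on_le) simp
  then show False by simp
qed

text \<open>One point of each colour is picked from \<open>L \<inter> W\<close>; points of different
  colours on \<open>L\<close> are adjacent.\<close>

lemma rainbow_contains_complete:
  assumes "W \<subseteq> P" "rainbow_on s f W"
  shows "contains_copy (complete_graph s) (induced_subgraph (colour_graph f) W)"
proof -
  obtain L where L: "L \<in> \<L>" and sub: "{..<s} \<subseteq> (\<lambda>x. f (L, x)) ` (L \<inter> W)"
    using assms unfolding rainbow_on_def by blast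
  define g where "g i = inv_into (L \<inter> W) (\<lambda>x. f (L, x)) i" for i
  have g: "g i \<in> L" "g i \<in> W" "f (L, g i) = i" if "i < s" for i
  proof -
    have i: "i \<in> (\<lambda>x. f (L, x)) ` (L \<inter> W)"
      by (rule subsetD[OF sub]) (use that in simp)
    have "g i \<in> L \<inter> W"
      unfolding g_def by (rule inv_into_into[OF i])
    then show "g i \<in> L" "g i \<in> W" by simp_all
    show "f (L, g i) = i"
      unfolding g_def by (rule f_inv_into_f[OF i])
  qed
  have "inj_on g {..<s}"
    by (rule inj_on_inverseI[of _ "\<lambda>x. f (L, x)"]) (use g(3) in simp)
  moreover have "{g i, g j} \<in> edges (colour_graph f) \<and> {g i, g j} \<subseteq> W"
    if "i < s" "j < s" "i \<noteq> j" for i j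
  proof -
    have "f (L, g i) \<noteq> f (L, g j)"
      unfolding g(3)[OF that(1)] g(3)[OF that(2)] by (rule that(3))
    moreover from this have "g i \<noteq> g j" by metis
    ultimately show ?thesis
      unfolding edge_colour_graph_iff using g(1,2) that L by blast
  qed
  moreover have "g ` {..<s} \<subseteq> W"
    using g(2) by (simp add: image_subset_iff)
  ultimately show ?thesis
    unfolding contains_complete_graph_iff induced_subgraph_def fst_conv snd_conv mem_Collect_eq
    by blast
qed

section \<open>Union bound and first moment for random colourings\<close>

text \<open>
  If no line is rainbow on \<open>W\<close>, then every line \<open>L\<close> has a colour \<open>c L\<close> that is missing on
  \<open>W\<close>; the bound is a union bound over \<open>c\<close>.
\<close>

lemma card_no_rainbow_le:
  assumes W: "W \<subseteq> P" and s: "s \<ge> 1"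
  shows "real (card {f \<in> flags \<rightarrow>\<^sub>E {..<s}. \<not> rainbow_on s f W})
    \<le> real s ^ card \<L> * (1 - 1 / real s) ^ (card W * (q + 1)) * real s ^ card flags"
proof -
  define D where "D = (SIGMA L:\<L>. L \<inter> W)"
  define A where "A c = {f \<in> flags \<rightarrow>\<^sub>E {..<s}. \<forall>x\<in>D. f x \<noteq> c (fst x)}" for c :: "'a set \<Rightarrow> nat"
  have sub: "D \<subseteq> flags" by (auto simp: D_def flags_def)
  have D: "card D = card W * (q + 1)"
    unfolding D_def by (rule card_flags_over[OF W])
  have le: "card D \<le> card flags" by (rule card_mono[OF finite_flags sub])
  have cardA: "card (A c) = (s - 1) ^ card D * s ^ (card flags - card D)" if "c \<in> \<L> \<rightarrow>\<^sub>E {..<s}" for c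
    unfolding A_def using that
    by (intro card_functions_avoiding finite_flags sub) (auto simp: D_def PiE_iff)
  have finF: "finite (flags \<rightarrow>\<^sub>E {..<s})" by (intro finite_PiE finite_flags) simp
  have "{f \<in> flags \<rightarrow>\<^sub>E {..<s}. \<not> rainbow_on s f W} \<subseteq> (\<Union>c\<in>\<L> \<rightarrow>\<^sub>E {..<s}. A c)"
  proof
    fix f assume f: "f \<in> {f \<in> flags \<rightarrow>\<^sub>E {..<s}. \<not> rainbow_on s f W}"
    then have "\<forall>L\<in>\<L>. \<exists>i. i < s \<and> i \<notin> (\<lambda>x. f (L, x)) ` (L \<inter> W)"
      unfolding rainbow_on_def by auto
    from bchoice[OF this] obtain c where c: "\<forall>L\<in>\<L>. c L < s \<and> c L \<notin> (\<lambda>x. f (L, x)) ` (L \<inter> W)"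
      by blast
    \<comment> \<open>Restricting \<open>c\<close> to the lines makes it one of the
      \<open>s ^ card \<L>\<close> functions in the union.\<close>
    have "f x \<noteq> restrict c \<L> (fst x)" if x: "x \<in> D" for x
    proof -
      obtain L y where "x = (L, y)" "L \<in> \<L>" "y \<in> L \<inter> W"
        using x unfolding D_def by blast
      then show ?thesis using c by force
    qed
    then have "f \<in> A (restrict c \<L>)"
      using f unfolding A_def by simp
    moreover have "restrict c \<L> \<in> \<L> \<rightarrow>\<^sub>E {..<s}"
      using c by simp
    ultimately show "f \<in> (\<Union>c\<in>\<L> \<rightarrow>\<^sub>E {..<s}. A c)" by blast
  qed
  moreover have finL: "finite (\<L> \<rightarrow>\<^sub>E {..<s})" by (intro finite_PiE finite_lines) simp
  moreover have "finite (A c)" for c using finF by (simp add: A_def)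
  ultimately have "card {f \<in> flags \<rightarrow>\<^sub>E {..<s}. \<not> rainbow_on s f W} \<le> card (\<Union>c\<in>\<L> \<rightarrow>\<^sub>E {..<s}. A c)"
    by (intro card_mono finite_UN_I)
  also have "\<dots> \<le> (\<Sum>c\<in>\<L> \<rightarrow>\<^sub>E {..<s}. card (A c))"
    by (rule card_UN_le[OF finL])
  also have "\<dots> = s ^ card \<L> * ((s - 1) ^ card D * s ^ (card flags - card D))"
    using cardA finite_lines by (simp add: card_funcsetE)
  finally have "real (card {f \<in> flags \<rightarrow>\<^sub>E {..<s}. \<not> rainbow_on s f W})
      \<le> real (s ^ card \<L> * ((s - 1) ^ card D * s ^ (card flags - card D)))"
    by (rule of_nat_mono)
  also have "\<dots> = real s ^ card \<L> * (1 - 1 / real s) ^ card D * real s ^ card flags"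
  proof -
    have "1 - 1 / real s = real (s - 1) / real s"
      using s by (simp add: of_nat_diff diff_divide_distrib)
    then have "(1 - 1 / real s) ^ card D * real s ^ card flags
        = real (s - 1) ^ card D * real s ^ (card flags - card D)"
      using s le by (simp add: power_divide power_diff)
    then show ?thesis by simp
  qed
  finally show ?thesis unfolding D .
qed

text \<open>First moment in counting form: after exchanging the sums, each pair is monochromatic in
  at most a fraction \<open>1/s\<close> of the colourings.\<close>

lemma sum_card_mono_pairs_le:
  "(\<Sum>f\<in>flags \<rightarrow>\<^sub>E {..<s}. card (mono_pairs f)) \<le> card collinear_pairs * s ^ (card flags - 1)"
proof -
  have fin: "finite (flags \<rightarrow>\<^sub>E {..<s})" by (intro finite_PiE finite_flags) simp
  have "(\<Sum>f\<in>flags \<rightarrow>\<^sub>E {..<s}. card (mono_pairs f))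
      = (\<Sum>f\<in>flags \<rightarrow>\<^sub>E {..<s}. card {t \<in> collinear_pairs. t \<in> mono_pairs f})"
    by (intro sum.cong refl arg_cong[where f = card]) (auto simp: mono_pairs_def)
  also have "\<dots> = (\<Sum>t\<in>collinear_pairs. card {f \<in> flags \<rightarrow>\<^sub>E {..<s}. t \<in> mono_pairs f})"
    by (rule sum_multicount_gen) (use fin finite_collinear_pairs in auto)
  also have "\<dots> \<le> (\<Sum>t\<in>collinear_pairs. s ^ (card flags - 1))"
  proof (rule sum_mono)
    fix t assume t: "t \<in> collinear_pairs"
    then obtain L e where te: "t = (L, e)" "L \<in> \<L>" "e \<in> nsets L 2"
      unfolding collinear_pairs_def by blast
    then obtain x y where xy: "e = {x, y}" "x \<in> L" "y \<in> L" "x \<noteq> y"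
      using nsets2_E by metis
    have "{f \<in> flags \<rightarrow>\<^sub>E {..<s}. t \<in> mono_pairs f} \<subseteq> {f \<in> flags \<rightarrow>\<^sub>E {..<s}. f (L, x) = f (L, y)}"
      unfolding te xy mono_pairs_def by auto
    then have "card {f \<in> flags \<rightarrow>\<^sub>E {..<s}. t \<in> mono_pairs f}
        \<le> card {f \<in> flags \<rightarrow>\<^sub>E {..<s}. f (L, x) = f (L, y)}"
      using fin by (intro card_mono) auto
    also have "\<dots> \<le> card {..<s} ^ (card flags - 1)"
      using te xy by (intro card_functions_agreeing_le finite_flags) (auto simp: flags_def)
    finally show "card {f \<in> flags \<rightarrow>\<^sub>E {..<s}. t \<in> mono_pairs f} \<le> s ^ (card flags - 1)"
      by simp
  qed
  finally show ?thesis by simp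
qed

text \<open>Two bad events are excluded at once. By the union bound some \<open>m\<close>-set fails
  to be rainbow with probability below 1/3. By Markov's inequality more than 3/4 of the pairs are
  monochromatic with probability at most \<open>(1/2) / (3/4) = 2/3\<close>, as
  \<open>1/s \<le> 1/2\<close>.\<close>

lemma ex_good_colouring:
  assumes p: "p \<ge> 1" and s: "s \<ge> 2"
    and small: "real (card P) ^ m * real s ^ card \<L> * (1 - 1 / real s) ^ (m * (q + 1)) < 1 / 3"
  shows "\<exists>f\<in>flags \<rightarrow>\<^sub>E {..<s}. (\<forall>W\<subseteq>P. card W = m \<longrightarrow> rainbow_on s f W) \<and>
    4 * card (mono_pairs f) \<le> 3 * card collinear_pairs"
proof (rule ccontr)
  assume contra: "\<not> ?thesis"
  define Col where "Col = (flags \<rightarrow>\<^sub>E {..<s})"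
  define Bad where "Bad W = {f \<in> Col. \<not> rainbow_on s f W}" for W
  define Ws where "Ws = {W. W \<subseteq> P \<and> card W = m}"
  define H where "H = {f \<in> Col. 3 * card collinear_pairs < 4 * card (mono_pairs f)}"
  define X where "X = real s ^ card \<L> * (1 - 1 / real s) ^ (m * (q + 1))"
  have finCol: "finite Col" unfolding Col_def by (intro finite_PiE finite_flags) simp
  have cardCol: "card Col = s ^ card flags"
    unfolding Col_def by (simp add: card_funcsetE finite_flags)
  have finWs: "finite Ws" unfolding Ws_def using finite_points by simp
  \<comment> \<open>Positivity uses \<open>p \<ge> 1\<close>. It allows cancelling the number of
    pairs in Markov's inequality and shows that flags exist, so that \<open>card flags - 1\<close>
    is not truncated.\<close>
  have pos: "card collinear_pairs > 0"
    using p by (simp add: card_collinear_pairs card_lines zero_less_binomial)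
  then obtain L e where "L \<in> \<L>" "e \<in> nsets L 2"
    unfolding collinear_pairs_def by (fastforce simp: card_gt_0_iff)
  then have "flags \<noteq> {}"
    using line_nonempty unfolding flags_def by blast
  then have flags_pos: "card flags > 0" by (simp add: card_gt_0_iff finite_flags)
  have X0: "X \<ge> 0" unfolding X_def using s by simp
  have "Col \<subseteq> (\<Union>W\<in>Ws. Bad W) \<union> H"
  proof
    fix f assume "f \<in> Col"
    then have "\<not> ((\<forall>W\<subseteq>P. card W = m \<longrightarrow> rainbow_on s f W) \<and> 4 * card (mono_pairs f) \<le> 3 * card collinear_pairs)"
      using contra unfolding Col_def by blast
    then show "f \<in> (\<Union>W\<in>Ws. Bad W) \<union> H"
      using \<open>f \<in> Col\<close> by (auto simp: Ws_def Bad_def H_def)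
  qed
  then have "card Col \<le> card ((\<Union>W\<in>Ws. Bad W) \<union> H)"
    using finCol finWs by (intro card_mono) (auto simp: Bad_def H_def)
  also have "\<dots> \<le> card (\<Union>W\<in>Ws. Bad W) + card H"
    by (rule card_Un_le)
  also have "\<dots> \<le> (\<Sum>W\<in>Ws. card (Bad W)) + card H"
    by (intro add_right_mono card_UN_le finWs)
  finally have "real (card Col) \<le> (\<Sum>W\<in>Ws. real (card (Bad W))) + real (card H)"
    by (metis of_nat_add of_nat_le_iff of_nat_sum)
  moreover have "(\<Sum>W\<in>Ws. real (card (Bad W))) < real (card Col) / 3"
  proof -
    have "(\<Sum>W\<in>Ws. real (card (Bad W))) \<le> (\<Sum>W\<in>Ws. X * real (card Col))"
    proof (rule sum_mono)
      fix W assume "W \<in> Ws"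
      then have "W \<subseteq> P" "card W = m" by (simp_all add: Ws_def)
      then show "real (card (Bad W)) \<le> X * real (card Col)"
        using card_no_rainbow_le[of W s] s cardCol unfolding Bad_def Col_def X_def by simp
    qed
    also have "\<dots> = real (card Ws) * (X * real (card Col))"
      by simp
    also have "\<dots> \<le> real (card P) ^ m * (X * real (card Col))"
    proof (rule mult_right_mono)
      have "card Ws = card P choose m"
        unfolding Ws_def by (rule n_subsets[OF finite_points])
      also have "\<dots> \<le> card P ^ m"
        by (cases "m \<le> card P") (simp_all add: binomial_le_pow binomial_eq_0)
      finally show "real (card Ws) \<le> real (card P) ^ m"
        by (metis of_nat_le_iff of_nat_power)
    qed (use X0 in simp)
    also have "\<dots> = (real (card P) ^ m * X) * real (card Col)"
      by simp
    also have "\<dots> < 1 / 3 * real (card Col)"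
      using small s cardCol unfolding X_def by (intro mult_strict_right_mono) (simp_all add: mult.assoc)
    finally show ?thesis by simp
  qed
  moreover have "real (card H) \<le> 2 / 3 * real (card Col)"
  proof -
    \<comment> \<open>Markov's inequality for \<open>mono_pairs\<close>, multiplied out over the
      naturals.\<close>
    have "3 * card collinear_pairs * card H = (\<Sum>f\<in>H. 3 * card collinear_pairs)"
      by simp
    also have "\<dots> \<le> (\<Sum>f\<in>H. 4 * card (mono_pairs f))"
      by (rule sum_mono) (simp add: H_def)
    also have "\<dots> \<le> (\<Sum>f\<in>Col. 4 * card (mono_pairs f))"
      by (rule sum_mono2[OF finCol]) (auto simp: H_def)
    also have "\<dots> \<le> 4 * (card collinear_pairs * s ^ (card flags - 1))"
      using sum_card_mono_pairs_le[of s] unfolding Col_def by (simp flip: sum_distrib_left)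
    also have "\<dots> \<le> 2 * card collinear_pairs * card Col"
    proof -
      have "2 * s ^ (card flags - 1) \<le> s * s ^ (card flags - 1)"
        using s by (rule mult_right_mono) simp
      also have "\<dots> = card Col"
        using flags_pos cardCol by (simp flip: power_Suc)
      finally have "2 * card collinear_pairs * (2 * s ^ (card flags - 1)) \<le> 2 * card collinear_pairs * card Col"
        by (rule mult_left_mono) simp
      then show ?thesis by (simp add: mult.assoc mult.left_commute)
    qed
    finally have "card collinear_pairs * (3 * card H) \<le> card collinear_pairs * (2 * card Col)"
      by (simp add: mult.assoc mult.left_commute)
    then have "3 * card H \<le> 2 * card Col"
      using pos by simp
    then have "3 * real (card H) \<le> 2 * real (card Col)"
      by (metis of_nat_le_iff of_nat_mult of_nat_numeral)
    then show ?thesis by simp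
  qed
  ultimately show False by linarith
qed

lemma colour_graph_RT:
  assumes p: "p \<ge> 1" and s: "s \<ge> 2"
    and small: "real (card P) ^ m * real s ^ card \<L> * (1 - 1 / real s) ^ (m * (q + 1)) < 1 / 3"
  shows "\<exists>G :: 'a ugraph. simple_graph G \<and> verts G = P \<and>
    \<not> contains_copy (complete_graph (s + 1)) G \<and> alpha s G < m \<and>
    card collinear_pairs \<le> 4 * card (edges G)"
proof -
  obtain f where f: "f \<in> flags \<rightarrow>\<^sub>E {..<s}" "\<forall>W\<subseteq>P. card W = m \<longrightarrow> rainbow_on s f W"
    "4 * card (mono_pairs f) \<le> 3 * card collinear_pairs"
    using ex_good_colouring[OF assms] by blast
  have "f (L, x) < s" if "L \<in> \<L>" "x \<in> L" for L x
    using PiE_mem[OF f(1), of "(L, x)"] that by (simp add: flags_def)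
  then have "\<not> contains_copy (complete_graph (s + 1)) (colour_graph f)"
    by (rule colour_graph_clique_free[OF s])
  moreover have V: "verts (colour_graph f) = P"
    by (simp add: colour_graph_def)
  moreover have "alpha s (colour_graph f) < m"
    using f(2) rainbow_contains_complete[of _ s f] s finite_points V
    by (intro alpha_lessI) simp_all
  moreover have "card collinear_pairs \<le> 4 * card (edges (colour_graph f))"
    using f(3) unfolding card_edges_colour_graph by linarith
  ultimately show ?thesis
    using simple_colour_graph by blast
qed

end

section \<open>Numerical estimates and the choice of constants\<close>

text \<open>With \<open>x = s * p * q\<^sup>2\<close> the three factors are at most
  \<open>exp (4 * x)\<close>, \<open>exp (4 * x)\<close> and \<open>exp (- 16 * x)\<close>. The size
  \<open>16 * s\<^sup>2 * p * q\<close> of the sets is chosen so that the last one wins.\<close>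

lemma (in gen_quad) union_bound_small:
  assumes s: "s \<ge> 2" and q: "q \<ge> 4 * (24 * s) ^ 6" and p: "p \<ge> 2"
  shows "real (card P) ^ (16 * s\<^sup>2 * p * q) * real s ^ card \<L>
    * (1 - 1 / real s) ^ (16 * s\<^sup>2 * p * q * (q + 1)) < 1 / 3"
proof -
  let ?m = "16 * s\<^sup>2 * p * q"
  define a b t where "a = real p" and "b = real q" and "t = real s"
  have t: "t \<ge> 2" using s by (simp add: t_def)
  have q2: "q \<ge> 2"
  proof -
    have "1 \<le> (24 * s) ^ 6" using s by simp
    then show ?thesis using q by linarith
  qed
  have a: "a \<ge> 2" and b: "b \<ge> 2" using p q2 by (simp_all add: a_def b_def)
  \<comment> \<open>Higman's inequality removes \<open>p\<close> from the bound, which makes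
    \<open>ln (card P)\<close> logarithmic in \<open>q\<close> alone.\<close>
  have "card P \<le> 4 * q ^ 5"
  proof -
    have "1 \<le> p * q" using p q2 by simp
    then have "card P \<le> (2 * (p * q)) * (2 * p)"
      unfolding card_points using p by (intro mult_mono) auto
    also have "\<dots> = 4 * p\<^sup>2 * q" by (simp add: power2_eq_square)
    also have "\<dots> \<le> 4 * (q\<^sup>2)\<^sup>2 * q"
      using higman[OF p q2] by (intro mult_right_mono mult_left_mono power_mono) auto
    also have "\<dots> = 4 * q ^ 5"
      using power_add[of q 4 1] by (simp flip: power_mult)
    finally show ?thesis .
  qed
  then have "real (card P) \<le> real (4 * q ^ 5)"
    by (rule of_nat_mono)
  also have "\<dots> = 4 * b ^ 5"
    by (simp add: b_def)
  \<comment> \<open>The sixth power beats \<open>b ^ 5\<close> by the lower bound on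
    \<open>q\<close>. As \<open>24 = 6 * 4\<close>, it turns into \<open>exp (b / (4 * t))\<close>
    below, and the power \<open>?m\<close> of that is
    \<open>exp (4 * t * a * b\<^sup>2)\<close>.\<close>
  also have "\<dots> \<le> (b / (24 * t)) ^ 6"
  proof -
    have "real (4 * (24 * s) ^ 6) \<le> real q"
      using q by (rule of_nat_mono)
    then have "4 * (24 * t) ^ 6 \<le> b"
      by (simp add: b_def t_def)
    then have "4 * (24 * t) ^ 6 * b ^ 5 \<le> b * b ^ 5"
      using b by (intro mult_right_mono) auto
    also have "b * b ^ 5 = b ^ 6" by (simp flip: power_Suc)
    finally show ?thesis
      using t by (simp add: power_divide pos_le_divide_eq mult.commute mult.left_commute)
  qed
  also have "\<dots> \<le> exp (b / (24 * t)) ^ 6"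
    using t b exp_ge_add_one_self[of "b / (24 * t)"] by (intro power_mono) (auto simp: field_simps)
  also have "\<dots> = exp (b / (4 * t))"
    by (simp flip: exp_of_nat_mult)
  finally have "real (card P) ^ ?m \<le> exp (b / (4 * t)) ^ ?m"
    by (intro power_mono) auto
  also have "\<dots> = exp (4 * t * a * b\<^sup>2)"
    using t by (simp add: a_def b_def t_def field_simps power2_eq_square flip: exp_of_nat_mult)
  finally have 1: "real (card P) ^ ?m \<le> exp (4 * t * a * b\<^sup>2)" .
  have "t \<le> exp t"
    using exp_ge_add_one_self[of t] by linarith
  then have "real s ^ card \<L> \<le> exp t ^ card \<L>"
    unfolding t_def by (intro power_mono) auto
  also have "\<dots> = exp (real (card \<L>) * t)"
    by (simp add: exp_of_nat_mult)
  also have "\<dots> \<le> exp (4 * t * a * b\<^sup>2)"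
  proof -
    have "1 \<le> a * b" using a b mult_mono[of 1 a 1 b] by simp
    have "real (card \<L>) = (a * b + 1) * (b + 1)"
      by (simp add: card_lines a_def b_def algebra_simps)
    also have "\<dots> \<le> (2 * (a * b)) * (2 * b)"
      using \<open>1 \<le> a * b\<close> b by (intro mult_mono) auto
    finally have "real (card \<L>) * t \<le> (2 * (a * b)) * (2 * b) * t"
      using t by (intro mult_right_mono) auto
    then show ?thesis by (simp add: power2_eq_square mult_ac)
  qed
  finally have 2: "real s ^ card \<L> \<le> exp (4 * t * a * b\<^sup>2)" .
  have "1 - 1 / t \<le> exp (- 1 / t)" and "0 \<le> 1 - 1 / t"
    using exp_ge_add_one_self[of "- 1 / t"] t by simp_all
  then have "(1 - 1 / real s) ^ (?m * (q + 1)) \<le> exp (- 1 / t) ^ (?m * (q + 1))"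
    unfolding t_def by (rule power_mono)
  also have "\<dots> = exp (real (?m * (q + 1)) * (- 1 / t))"
    by (rule exp_of_nat_mult[symmetric])
  also have "\<dots> = exp (- (16 * t * a * b * (b + 1)))"
    using t by (simp add: a_def b_def t_def field_simps power2_eq_square)
  also have "\<dots> \<le> exp (- (16 * t * a * b\<^sup>2))"
  proof -
    have "16 * t * a * b * b \<le> 16 * t * a * b * (b + 1)"
      using a b t by (intro mult_left_mono) auto
    then show ?thesis by (simp add: power2_eq_square)
  qed
  finally have 3: "(1 - 1 / real s) ^ (?m * (q + 1)) \<le> exp (- (16 * t * a * b\<^sup>2))" .
  have "real (card P) ^ ?m * real s ^ card \<L> * (1 - 1 / real s) ^ (?m * (q + 1))
      \<le> exp (4 * t * a * b\<^sup>2) * exp (4 * t * a * b\<^sup>2) * exp (- (16 * t * a * b\<^sup>2))"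
    using 1 2 3 s by (intro mult_mono) auto
  also have "\<dots> = exp (- (8 * (t * a * b\<^sup>2)))"
    by (simp flip: exp_add)
  also have "\<dots> \<le> exp (- 8)"
  proof -
    have "1 \<le> b\<^sup>2" using b by (simp add: power2_eq_square mult_ge1_I)
    moreover have "1 \<le> t * a" using t a mult_mono[of 1 t 1 a] by simp
    ultimately have "1 \<le> t * a * b\<^sup>2"
      using mult_mono[of 1 "t * a" 1 "b\<^sup>2"] by simp
    then show ?thesis by simp
  qed
  also have "\<dots> < 1 / 3"
  proof -
    have "9 \<le> exp (8 :: real)" using exp_ge_add_one_self[of 8] by simp
    then show ?thesis by (simp add: exp_minus field_simps)
  qed
  finally show ?thesis .
qed

theorem theorem6p2:
  fixes s :: nat
  assumes "s \<ge> 2"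
  shows "\<exists>C c\<^sub>1 c\<^sub>2 :: real. C > 0 \<and> c\<^sub>1 > 0 \<and> c\<^sub>2 > 0 \<and>
    (\<exists>N :: nat. \<forall>p q :: nat. p \<ge> N \<longrightarrow> q \<ge> N \<longrightarrow> GQ_exists p q \<longrightarrow>
      c\<^sub>1 * real p ^ 3 * real q ^ 2
        \<le> real (RT s ((p * q + 1) * (p + 1)) (complete_graph (s + 1)) (C * real p * real q)) \<and>
      real (RT s ((p * q + 1) * (p + 1)) (complete_graph (s + 1)) (C * real p * real q))
        \<le> c\<^sub>2 * real p ^ 3 * real q ^ 2)"
proof -
  \<comment> \<open>\<open>C * p * q\<close> is the set size in \<open>union_bound_small\<close>,
    and \<open>N\<close> is its threshold for \<open>q\<close>; \<open>N \<ge> 2\<close> also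
    supplies \<open>p \<ge> 2\<close>.\<close>
  define C where "C = 16 * (real s)\<^sup>2"
  define N where "N = 4 * (24 * s) ^ 6"
  have C: "C > 0" using assms by (simp add: C_def)
  have N: "N \<ge> 2"
  proof -
    have "1 \<le> (24 * s) ^ 6" using assms by simp
    then show ?thesis unfolding N_def by linarith
  qed
  \<comment> \<open>The factor 1/8 arises because there are at least
    \<open>p ^ 3 * q\<^sup>2 / 2\<close> collinear pairs and a quarter of them become edges. The
    factor \<open>4 * C\<close> arises from \<open>n \<le> 4 * p\<^sup>2 * q\<close> and
    \<open>RT_le\<close>.\<close>
  have bounds: "1 / 8 * real p ^ 3 * real q ^ 2
        \<le> real (RT s ((p * q + 1) * (p + 1)) (complete_graph (s + 1)) (C * real p * real q)) \<and>
      real (RT s ((p * q + 1) * (p + 1)) (complete_graph (s + 1)) (C * real p * real q))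
        \<le> 4 * C * real p ^ 3 * real q ^ 2"
    if p: "p \<ge> N" and q: "q \<ge> N" and ex: "GQ_exists p q" for p q
  proof
    define n where "n = (p * q + 1) * (p + 1)"
    have p2: "p \<ge> 2" and q2: "q \<ge> 2" using p q N by simp_all
    obtain P :: "nat set" and \<L> where PL: "generalized_quadrangle P \<L> p q"
      using ex by (auto simp: GQ_exists_def)
    then interpret PQ: gen_quad P \<L> p q by unfold_locales
    obtain h where h: "bij_betw h P {..<n}"
      using ex_bij_betw_finite_nat[OF PQ.finite_points] PQ.card_points
      unfolding n_def atLeast0LessThan by metis
    have "generalized_quadrangle {..<n} ((`) h ` \<L>) p q"
      using generalized_quadrangle_image[OF PL bij_betw_imp_inj_on[OF h]] bij_betw_imp_surj_on[OF h] by simp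
    then interpret Q: gen_quad "{..<n}" "(`) h ` \<L>" p q by unfold_locales
    obtain G where G: "simple_graph G" "verts G = {..<n}"
      "\<not> contains_copy (complete_graph (s + 1)) G" "alpha s G < 16 * s\<^sup>2 * p * q"
      "card Q.collinear_pairs \<le> 4 * card (edges G)"
      using Q.colour_graph_RT[OF _ assms Q.union_bound_small[OF assms _ p2]] p2 q unfolding N_def by auto
    have "real (alpha s G) < real (16 * s\<^sup>2 * p * q)"
      using G(4) by (simp only: of_nat_less_iff)
    then have "real (alpha s G) < C * real p * real q"
      by (simp add: C_def)
    then have "G \<in> RT_graphs s n (complete_graph (s + 1)) (C * real p * real q)"
      using G by (simp add: RT_graphs_def)
    then have low: "card (edges G) \<le> RT s n (complete_graph (s + 1)) (C * real p * real q)"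
      by (rule card_edges_le_RT)
    have "p ^ 3 * q\<^sup>2 \<le> (p * q + 1) * (q + 1) * ((p + 1) * p)"
    proof -
      have "p ^ 3 * q\<^sup>2 = p * q * q * (p * p)" by (simp add: power3_eq_cube power2_eq_square)
      also have "\<dots> \<le> (p * q + 1) * (q + 1) * ((p + 1) * p)" by (intro mult_mono) auto
      finally show ?thesis .
    qed
    also have "\<dots> = 2 * card Q.collinear_pairs"
      unfolding Q.card_collinear_pairs Q.card_lines by (simp add: choose_two)
    finally have "p ^ 3 * q\<^sup>2 \<le> 8 * card (edges G)"
      using G(5) by linarith
    then have "p ^ 3 * q\<^sup>2 \<le> 8 * RT s n (complete_graph (s + 1)) (C * real p * real q)"
      using low by linarith
    then have "real (p ^ 3 * q\<^sup>2) \<le> real (8 * RT s n (complete_graph (s + 1)) (C * real p * real q))"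
      by (simp only: of_nat_le_iff)
    then show "1 / 8 * real p ^ 3 * real q ^ 2
        \<le> real (RT s ((p * q + 1) * (p + 1)) (complete_graph (s + 1)) (C * real p * real q))"
      unfolding n_def by simp
    have "1 \<le> p * q" using p2 q2 by simp
    then have "n \<le> (2 * (p * q)) * (2 * p)"
      unfolding n_def using p2 by (intro mult_mono) auto
    then have "real n \<le> real ((2 * (p * q)) * (2 * p))"
      by (simp only: of_nat_le_iff)
    then have "real n * (C * real p * real q) \<le> real ((2 * (p * q)) * (2 * p)) * (C * real p * real q)"
      using C by (intro mult_right_mono) auto
    also have "\<dots> = 4 * C * real p ^ 3 * real q ^ 2"
      by (simp add: power3_eq_cube power2_eq_square)
    finally have "real n * (C * real p * real q) \<le> 4 * C * real p ^ 3 * real q ^ 2" .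
    moreover have "0 \<le> C * real p * real q" using C by simp
    ultimately show "real (RT s ((p * q + 1) * (p + 1)) (complete_graph (s + 1)) (C * real p * real q))
        \<le> 4 * C * real p ^ 3 * real q ^ 2"
      using RT_le[of "C * real p * real q" s n] unfolding n_def by linarith
  qed
  have "1 / 8 > (0 :: real)" "4 * C > 0" using C by simp_all
  then show ?thesis using C bounds by blast
qed

end
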